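(* Let $p$ be a prime and $k,m$ integers with $3\le m\le k$, and suppose $p$ does not divide $S(k,m)$. Then there are constants $C_k\ge 1$ (depending only on $k$) and $1\le \Gamma_{p,m}<p$ (depending only on $p,m$) such that for every $n\ge1$, every $a_1,\ldots,a_k\in\mathbb{F}_p$ with $a_1+\cdots+a_k=0$, and every $A\subseteq\mathbb{F}_p^n$ with $|A|>C_k\Gamma_{p,m}^n$, there exist $\vec{x}_1,\ldots,\vec{x}_k\in A$, not all equal, taking at most $m$ distinct values, with $a_1\vec{x}_1+\cdots+a_k\vec{x}_k=\vec{0}$.
   Context: $S(k,m)$ denotes the Stirling number of the second kind: the number of partitions of $\{1,\ldots,k\}$ into exactly $m$ blocks. *)

theory Defs
  imports
    Complex_Main
    "HOL-Library.FuncSet"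
    "HOL-Library.Disjoint_Sets"
    "HOL-Combinatorics.Stirling"
    "HOL-Number_Theory.Residues"
begin

text \<open>
  \<open>Stirling\<close> is introduced in the library by its recurrence. The corollary
  \<open>Stirling_eq_card_partitions\<close> confirms that \<open>Stirling k m\<close> counts the partitions of
  \<open>{1..k}\<close> into exactly \<open>m\<close> blocks.
\<close>

lemma finite_partitions_card: "finite A \<Longrightarrow> finite {P. partition_on A P \<and> card P = m}"
  by (rule finite_subset[OF _ finitely_many_partition_on[of A]]) auto

lemma partition_on_remove:
  assumes P: "partition_on A P" and B: "B \<in> P"
  shows "partition_on (A - B) (P - {B})"
proof -
  have "disjnt B X" if "X \<in> P - {B}" for X
    using P B that pairwiseD[of disjnt P B X] by (auto simp: partition_on_def)
  then have "disjnt B (\<Union>(P - {B}))" by (auto simp: disjnt_def)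
  moreover have "partition_on A (insert B (P - {B}))" using P B by (simp only: insert_Diff)
  ultimately show ?thesis by (rule partition_on_insert[THEN iffD1, THEN conjunct1])
qed

lemma card_partitions_insert:
  fixes A :: "'a set"
  assumes fin: "finite A" and a: "a \<notin> A"
  defines "Part \<equiv> \<lambda>(B :: 'a set) m. {P. partition_on B P \<and> card P = m}"
  shows "card (Part (insert a A) (Suc j)) = Suc j * card (Part A (Suc j)) + card (Part A j)"
proof -
  let ?N = "Part (insert a A) (Suc j)"
  have finP: "finite P" if "P \<in> Part B m" "finite B" for P B m
    using that finite_elements by (auto simp: Part_def)
  have aP: "a \<notin> X" if "P \<in> Part A m" "X \<in> P" for P X m
    using that a by (auto simp: Part_def partition_on_def)
  have "bij_betw (insert {a}) (Part A j) {Q \<in> ?N. {a} \<in> Q}"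
  proof (rule bij_betw_byWitness[where f' = "\<lambda>Q. Q - {{a}}"])
    show "\<forall>P\<in>Part A j. insert {a} P - {{a}} = P" using aP by fastforce
    show "\<forall>Q\<in>{Q \<in> ?N. {a} \<in> Q}. insert {a} (Q - {{a}}) = Q" by auto
    show "insert {a} ` Part A j \<subseteq> {Q \<in> ?N. {a} \<in> Q}"
    proof clarify
      fix P assume P: "P \<in> Part A j"
      have "{a} \<notin> P" using aP[OF P] by auto
      moreover have "partition_on (insert a A) (insert {a} P)"
        using P aP[OF P] by (auto simp: Part_def partition_on_def pairwise_insert disjnt_def)
      ultimately show "insert {a} P \<in> ?N \<and> {a} \<in> insert {a} P"
        using P finP[OF P fin] by (auto simp: Part_def)
    qed
    show "(\<lambda>Q. Q - {{a}}) ` {Q \<in> ?N. {a} \<in> Q} \<subseteq> Part A j"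
    proof clarify
      fix Q assume Q: "Q \<in> ?N" "{a} \<in> Q"
      have "partition_on (insert a A - {a}) (Q - {{a}})"
        using Q by (intro partition_on_remove) (auto simp: Part_def)
      then show "Q - {{a}} \<in> Part A j"
        using Q a by (simp add: Part_def)
    qed
  qed
  then have c1: "card {Q \<in> ?N. {a} \<in> Q} = card (Part A j)"
    by (simp add: bij_betw_same_card)
  define T where "T = Sigma (Part A (Suc j)) (\<lambda>P. P)"
  define g where "g = (\<lambda>(P, B). insert (insert a B) (P - {B :: 'a set}))"
  define h where "h = (\<lambda>Q. ((\<lambda>X. X - {a}) ` Q, \<Union>{X \<in> Q. a \<in> X} - {a}))"
  have "bij_betw g T {Q \<in> ?N. {a} \<notin> Q}"
  proof (rule bij_betw_byWitness[where f' = h])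
    show "\<forall>t\<in>T. h (g t) = t"
    proof clarify
      fix P B assume "(P, B) \<in> T"
      then have P: "P \<in> Part A (Suc j)" and B: "B \<in> P" by (auto simp: T_def)
      have id: "X - {a} = X" if "X \<in> P" for X using aP[OF P that] by auto
      have "(\<lambda>X. X - {a}) ` g (P, B) = insert B (P - {B})"
        using id B by (auto simp: g_def image_def)
      moreover have "{X \<in> g (P, B). a \<in> X} = {insert a B}"
        using aP[OF P] by (auto simp: g_def)
      ultimately show "h (g (P, B)) = (P, B)"
        using B id[OF B] by (auto simp: h_def)
    qed
    have main: "\<exists>D. D \<in> Q \<and> a \<in> D \<and> D - {a} \<noteq> {} \<and> D - {a} \<notin> Q \<and>
        h Q = (insert (D - {a}) (Q - {D}), D - {a})"
      if Q: "Q \<in> ?N" "{a} \<notin> Q" for Q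
    proof -
      from Q have Qp: "partition_on (insert a A) Q" by (auto simp: Part_def)
      then obtain D where D: "D \<in> Q" "a \<in> D" by (auto simp: partition_on_def)
      have uniq: "a \<notin> X" if "X \<in> Q" "X \<noteq> D" for X
        using Qp D that by (auto simp: partition_on_def pairwise_def disjnt_def)
      have ne: "D - {a} \<noteq> {}" using D Q by (metis Diff_eq_empty_iff insert_absorb subset_singletonD empty_iff)
      have "D - {a} \<notin> Q"
      proof
        assume "D - {a} \<in> Q"
        then have "disjnt (D - {a}) D"
          using Qp D pairwiseD[of disjnt Q "D - {a}" D] by (auto simp: partition_on_def)
        then show False using ne by (auto simp: disjnt_def)
      qed
      have "{X \<in> Q. a \<in> X} = {D}" using D uniq by auto
      moreover have "(\<lambda>X. X - {a}) ` Q = insert (D - {a}) (Q - {D})"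
      proof -
        have "(\<lambda>X. X - {a}) ` (Q - {D}) = (\<lambda>X. X) ` (Q - {D})"
          by (rule image_cong) (use uniq in auto)
        moreover have "Q = insert D (Q - {D})" using D by auto
        ultimately show ?thesis by (metis image_insert image_ident)
      qed
      ultimately have "h Q = (insert (D - {a}) (Q - {D}), D - {a})" by (simp only: h_def) simp
      with D ne \<open>D - {a} \<notin> Q\<close> show ?thesis by blast
    qed
    show "\<forall>Q\<in>{Q \<in> ?N. {a} \<notin> Q}. g (h Q) = Q"
    proof clarify
      fix Q assume Q: "Q \<in> ?N" "{a} \<notin> Q"
      from main[OF Q] obtain D where D: "D \<in> Q" "a \<in> D" "D - {a} \<notin> Q"
        "h Q = (insert (D - {a}) (Q - {D}), D - {a})" by auto
      have "insert a (D - {a}) = D" using D by auto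
      moreover have "insert (D - {a}) (Q - {D}) - {D - {a}} = Q - {D}" using D by auto
      ultimately show "g (h Q) = Q" using D by (auto simp: g_def)
    qed
    show "g ` T \<subseteq> {Q \<in> ?N. {a} \<notin> Q}"
    proof clarify
      fix P B assume "(P, B) \<in> T"
      then have P: "P \<in> Part A (Suc j)" and B: "B \<in> P" by (auto simp: T_def)
      have Pp: "partition_on A P" and cP: "card P = Suc j" using P by (auto simp: Part_def)
      have Bne: "B \<noteq> {}" "a \<notin> B" using Pp B aP[OF P B] by (auto simp: partition_on_def)
      have new: "insert a B \<notin> P" "{a} \<notin> P" using aP[OF P] by blast+
      have "card (g (P, B)) = Suc j"
        using new B cP finP[OF P fin] by (simp add: g_def)
      moreover have "partition_on (insert a A) (g (P, B))"
      proof -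
        have rem: "partition_on (A - B) (P - {B})"
          by (rule partition_on_remove[OF Pp B])
        then have sub: "\<Union>(P - {B}) = A - B" by (simp only: partition_on_def)
        note rem
        moreover have "insert a A - insert a B = A - B" using a Bne by auto
        moreover have "B \<subseteq> A" using Pp B by (auto simp: partition_on_def)
        moreover have "disjnt (insert a B) (\<Union>(P - {B}))" using sub a by (auto simp: disjnt_def)
        ultimately have "partition_on (insert a A) (insert (insert a B) (P - {B}))"
          by (intro partition_on_insert[THEN iffD2]) (simp, simp, blast)
        then show ?thesis by (simp only: g_def prod.case)
      qed
      moreover have "{a} \<notin> g (P, B)" using new Bne by (auto simp: g_def)
      ultimately show "g (P, B) \<in> ?N \<and> {a} \<notin> g (P, B)" by (simp add: Part_def)
    qed
    show "h ` {Q \<in> ?N. {a} \<notin> Q} \<subseteq> T"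
    proof (rule image_subsetI)
      fix Q assume "Q \<in> {Q \<in> ?N. {a} \<notin> Q}"
      then have Q: "Q \<in> ?N" "{a} \<notin> Q" by auto
      from main[OF Q] obtain D where D: "D \<in> Q" "a \<in> D" "D - {a} \<noteq> {}" "D - {a} \<notin> Q"
        and hQ: "h Q = (insert (D - {a}) (Q - {D}), D - {a})" by auto
      have Qp: "partition_on (insert a A) Q" using Q by (auto simp: Part_def)
      have rem: "partition_on (insert a A - D) (Q - {D})"
        by (rule partition_on_remove[OF Qp D(1)])
      then have sub: "\<Union>(Q - {D}) = insert a A - D" by (simp only: partition_on_def)
      note rem
      moreover have "insert a A - D = A - (D - {a})" using a D by auto
      moreover have "D \<subseteq> insert a A" using Qp D by (auto simp: partition_on_def)
      moreover have "disjnt (D - {a}) (\<Union>(Q - {D}))" using sub by (auto simp: disjnt_def)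
      ultimately have "partition_on A (insert (D - {a}) (Q - {D}))"
        using D(3) by (intro partition_on_insert[THEN iffD2]) (simp, simp, blast)
      moreover have "card (insert (D - {a}) (Q - {D})) = Suc j"
        using Q D finP[OF Q(1)] fin by (simp add: Part_def)
      ultimately show "h Q \<in> T" by (simp add: hQ T_def Part_def)
    qed
  qed
  then have "card {Q \<in> ?N. {a} \<notin> Q} = card T" by (simp add: bij_betw_same_card)
  also have "\<dots> = (\<Sum>P\<in>Part A (Suc j). card P)"
    unfolding T_def by (rule card_SigmaI) (use fin finP finite_partitions_card in \<open>auto simp: Part_def\<close>)
  also have "\<dots> = Suc j * card (Part A (Suc j))" by (simp add: Part_def)
  finally have c2: "card {Q \<in> ?N. {a} \<notin> Q} = Suc j * card (Part A (Suc j))" .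
  have finN: "finite ?N" using fin by (simp add: Part_def finite_partitions_card)
  have "card ?N = card ({Q \<in> ?N. {a} \<notin> Q} \<union> {Q \<in> ?N. {a} \<in> Q})"
    by (rule arg_cong[where f = card]) auto
  also have "\<dots> = card {Q \<in> ?N. {a} \<notin> Q} + card {Q \<in> ?N. {a} \<in> Q}"
    by (rule card_Un_disjoint) (use finN in auto)
  finally show ?thesis by (simp only: c1 c2)
qed

lemma card_partitions_eq_Stirling:
  "finite A \<Longrightarrow> card {P. partition_on A P \<and> card P = m} = Stirling (card A) m"
proof (induction A arbitrary: m rule: finite_induct)
  case empty
  have "{P :: 'a set set. partition_on {} P \<and> card P = m} = (if m = 0 then {{}} else {})"
    by (auto simp: partition_on_empty)
  then have "card {P :: 'a set set. partition_on {} P \<and> card P = m} = (if m = 0 then 1 else 0)"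
    by (simp only: card.empty is_singletonI is_singleton_altdef[symmetric] split: if_split) simp
  then show ?case by (cases m) (simp_all only: card.empty Stirling.simps simp_thms if_True if_False nat.simps)
next
  case (insert a A)
  show ?case
  proof (cases m)
    case 0
    have "card P \<noteq> 0" if "partition_on (insert a A) P" for P
    proof -
      have "P \<noteq> {}" using that by (auto simp: partition_on_def)
      then show ?thesis using finite_elements[OF _ that] insert.hyps by simp
    qed
    then have "{P. partition_on (insert a A) P \<and> card P = 0} = {}" by blast
    then have "card {P. partition_on (insert a A) P \<and> card P = 0} = 0" by (simp only: card.empty)
    then show ?thesis using 0 insert.hyps by simp
  next
    case (Suc j)
    then show ?thesis
      using card_partitions_insert[OF insert.hyps(1,2)] insert.hyps insert.IH by simp
  qed
qed

corollary Stirling_eq_card_partitions: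
  "Stirling k m = card {P. partition_on {1..k} P \<and> card P = m}"
  by (simp add: card_partitions_eq_Stirling)

text \<open>
  The field with \<open>p\<close> elements has to be an explicit carrier, since the constants of the theorem
  are chosen before \<open>p\<close>. It is \<open>residue_ring (int p)\<close>, with carrier \<open>{0..int p - 1}\<close>.
  Vectors are extensional functions on \<open>{1..n}\<close>, so that equality of vectors and cardinality of
  sets of vectors have their usual meaning.
\<close>

abbreviation GFp :: "nat \<Rightarrow> int ring"
  where "GFp p \<equiv> residue_ring (int p)"

definition Fp_vectors :: "nat \<Rightarrow> nat \<Rightarrow> (nat \<Rightarrow> int) set"
  where "Fp_vectors p n = {1..n} \<rightarrow>\<^sub>E carrier (GFp p)"

definition zero_vector :: "nat \<Rightarrow> nat \<Rightarrow> nat \<Rightarrow> int"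
  where "zero_vector p n = (\<lambda>j\<in>{1..n}. \<zero>\<^bsub>GFp p\<^esub>)"

definition lin_comb :: "nat \<Rightarrow> nat \<Rightarrow> nat \<Rightarrow> (nat \<Rightarrow> int) \<Rightarrow> (nat \<Rightarrow> nat \<Rightarrow> int) \<Rightarrow> nat \<Rightarrow> int"
  where "lin_comb p n k a x =
    (\<lambda>j\<in>{1..n}. \<Oplus>\<^bsub>GFp p\<^esub>i\<in>{1..k}. a i \<otimes>\<^bsub>GFp p\<^esub> x i j)"

end

theory Submission
  imports Defs
begin

text \<open>
  Using the same vector for all indices \<open>i \<ge> 3\<close> reduces the problem to three unknown vectors
  with coefficients \<open>b1 + b2 + b3 = 0\<close>, so that \<open>\<Gamma>\<close> need only depend on \<open>p\<close> and \<open>C = 3\<close>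
  suffices. If all solutions in \<open>A\<close> are constant, then
  \<open>\<Prod>j. 1 - (b1 * x j + b2 * y j + b3 * z j) ^ (p - 1)\<close> is the diagonal tensor on \<open>A\<close>, which
  has slice rank \<open>|A|\<close>. Each of its monomials has degree at most \<open>(p - 1) * n / 3\<close> in one of
  \<open>x\<close>, \<open>y\<close>, \<open>z\<close>, which bounds \<open>|A|\<close> by three times the number of exponent vectors of such low
  degree. A Chernoff bound makes that number exponentially smaller than \<open>p ^ n\<close>.
  Throughout, elements of the field are represented by integers modulo \<open>p\<close>.
\<close>

section \<open>Linear algebra modulo p and slice rank\<close>

text \<open>Pigeonhole replaces dimension theory: there are \<open>p ^ card S\<close> coefficient
  vectors with entries in [0,p) but only \<open>p ^ card I\<close> tuples of values, so two vectors
  collide. Their difference solves the system and is nonzero modulo p where they differ.\<close>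

lemma homogeneous_system_mod:
  fixes c :: "'b \<Rightarrow> 'a \<Rightarrow> int"
  assumes p: "p > 1" and S: "finite S" and I: "finite I" and less: "card I < card S"
  obtains u :: "'a \<Rightarrow> int" and x where "x \<in> S" "\<not> int p dvd u x"
    "\<And>i. i \<in> I \<Longrightarrow> int p dvd (\<Sum>x\<in>S. u x * c i x)"
proof -
  let ?U = "S \<rightarrow>\<^sub>E {0..<int p}"
  define \<phi> where "\<phi> v = (\<lambda>i\<in>I. (\<Sum>x\<in>S. v x * c i x) mod int p)" for v
  have "\<phi> ` ?U \<subseteq> I \<rightarrow>\<^sub>E {0..<int p}" using p by (auto simp: \<phi>_def)
  then have "card (\<phi> ` ?U) \<le> card (I \<rightarrow>\<^sub>E {0..<int p})"
    by (intro card_mono finite_PiE I) auto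
  also have "\<dots> = p ^ card I" using I by (simp add: card_PiE)
  also have "\<dots> < p ^ card S" using less p by (intro power_strict_increasing) auto
  also have "\<dots> = card ?U" using S by (simp add: card_PiE)
  finally have "\<not> inj_on \<phi> ?U" by (rule pigeonhole)
  then obtain v w where vw: "v \<in> ?U" "w \<in> ?U" "\<phi> v = \<phi> w" "v \<noteq> w" by (auto simp: inj_on_def)
  then obtain x where x: "x \<in> S" "v x \<noteq> w x" by (meson PiE_ext)
  show thesis
  proof (rule that[of x "\<lambda>x. v x - w x"])
    show "x \<in> S" by (rule x)
    have "v x \<in> {0..<int p}" "w x \<in> {0..<int p}" using vw x by (auto simp: PiE_iff)
    then show "\<not> int p dvd v x - w x" using x
      by (metis atLeastLessThan_iff mod_eq_dvd_iff mod_pos_pos_trivial)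
    fix i assume "i \<in> I"
    then have "(\<Sum>x\<in>S. v x * c i x) mod int p = (\<Sum>x\<in>S. w x * c i x) mod int p"
      using fun_cong[OF vw(3), of i] by (simp add: \<phi>_def)
    then show "int p dvd (\<Sum>x\<in>S. (v x - w x) * c i x)"
      by (simp add: left_diff_distrib sum_subtractf mod_eq_dvd_iff)
  qed
qed

text \<open>The vectors orthogonal to all \<open>f i\<close> form a space of dimension at least
  \<open>card A - card I\<close>, and a vector of maximal support in it has at least that many
  nonzero entries.\<close>

lemma large_support_orthogonal:
  fixes f :: "'b \<Rightarrow> 'a \<Rightarrow> int"
  assumes p: "prime p" and A: "finite A" and I: "finite I"
  obtains h :: "'a \<Rightarrow> int" where "\<And>i. i \<in> I \<Longrightarrow> int p dvd (\<Sum>z\<in>A. h z * f i z)"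
    "card A \<le> card I + card {x \<in> A. \<not> int p dvd h x}"
proof -
  define W where "W h \<longleftrightarrow> (\<forall>i\<in>I. int p dvd (\<Sum>z\<in>A. h z * f i z))" for h
  define supp where "supp h = {x \<in> A. \<not> int p dvd h x}" for h :: "'a \<Rightarrow> int"
  have fin: "finite (supp h)" for h using A by (simp add: supp_def)
  have "W (\<lambda>_. 0)" by (simp add: W_def)
  moreover have "\<forall>h. W h \<longrightarrow> card (supp h) < Suc (card A)"
    using A by (auto simp: supp_def less_Suc_eq_le intro: card_mono)
  ultimately obtain h where h: "W h" "\<And>h'. W h' \<Longrightarrow> card (supp h') \<le> card (supp h)"
    using ex_has_greatest_nat[of W "\<lambda>_. 0" "card \<circ> supp" "Suc (card A)"] by (auto intro: less_imp_le)
  \<comment> \<open>Otherwise some nonzero orthogonal vector vanishes on the support of \<open>h\<close>, and adding it to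
    \<open>h\<close> enlarges the support.\<close>
  have "card A \<le> card I + card (supp h)"
  proof (rule ccontr)
    assume "\<not> card A \<le> card I + card (supp h)"
    \<comment> \<open>One system imposes both kinds of condition on \<open>u\<close>: the equations
      \<open>Inl i\<close> give orthogonality to \<open>f i\<close>, the equations
      \<open>Inr s\<close> make \<open>u s\<close> vanish modulo p.\<close>
    then have "card (I <+> supp h) < card A" using I fin by (simp add: card_Plus)
    then obtain u x where x: "x \<in> A" "\<not> int p dvd u x" and
      u: "\<And>e. e \<in> I <+> supp h \<Longrightarrow>
        int p dvd (\<Sum>x\<in>A. u x * (case e of Inl i \<Rightarrow> f i x | Inr s \<Rightarrow> if x = s then 1 else 0))"
      by (rule homogeneous_system_mod[OF prime_gt_1_nat[OF p] A finite_Plus[OF I fin[of h]], of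
            "\<lambda>e x. case e of Inl i \<Rightarrow> f i x | Inr s \<Rightarrow> if x = s then 1 else 0"])
        auto
    have uI: "int p dvd (\<Sum>x\<in>A. u x * f i x)" if "i \<in> I" for i
      using u[of "Inl i"] that by auto
    have us: "int p dvd u s" if "s \<in> supp h" for s
      using u[of "Inr s"] that A by (auto simp: supp_def if_distrib cong: if_cong)
    have "W (\<lambda>x. h x + u x)" using h(1) uI by (simp add: W_def distrib_right sum.distrib)
    moreover have "insert x (supp h) \<subseteq> supp (\<lambda>x. h x + u x)"
    proof (intro insert_subsetI subsetI)
      have "int p dvd h x" using x us by (auto simp: supp_def)
      then show "x \<in> supp (\<lambda>x. h x + u x)" using x by (simp add: supp_def dvd_add_right_iff)
      fix s assume "s \<in> supp h"
      then show "s \<in> supp (\<lambda>x. h x + u x)"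
        using us[of s] by (simp add: supp_def dvd_add_left_iff)
    qed
    then have "card (insert x (supp h)) \<le> card (supp (\<lambda>x. h x + u x))"
      by (intro card_mono fin)
    moreover have "x \<notin> supp h" using x us by auto
    ultimately show False using h(2)[of "\<lambda>x. h x + u x"] fin[of h] by simp
  qed
  then show thesis using h(1) by (intro that[of h]) (auto simp: W_def supp_def)
qed

text \<open>This is Tao's lower bound for the slice rank of a diagonal tensor. Contracting with a
  vector \<open>h\<close> orthogonal to every \<open>f3 i\<close> removes the third group of slices,
  so that a bound on matrix rank finishes the argument.\<close>

lemma slice_rank_diagonal:
  fixes f1 f2 f3 :: "'b \<Rightarrow> 'a \<Rightarrow> int" and g1 g2 g3 :: "'b \<Rightarrow> 'a \<Rightarrow> 'a \<Rightarrow> int"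
  assumes p: "prime p" and A: "finite A" and I: "finite I1" "finite I2" "finite I3"
    and T: "\<And>x y z. x \<in> A \<Longrightarrow> y \<in> A \<Longrightarrow> z \<in> A \<Longrightarrow>
      [(\<Sum>i\<in>I1. f1 i x * g1 i y z) + (\<Sum>i\<in>I2. f2 i y * g2 i x z) + (\<Sum>i\<in>I3. f3 i z * g3 i x y)
        = (if x = y \<and> y = z then 1 else 0)] (mod int p)"
  shows "card A \<le> card I1 + card I2 + card I3"
proof -
  obtain h where h: "\<And>i. i \<in> I3 \<Longrightarrow> int p dvd (\<Sum>z\<in>A. h z * f3 i z)"
    and card: "card A \<le> card I3 + card {x \<in> A. \<not> int p dvd h x}"
    by (rule large_support_orthogonal[OF p A I(3), of f3]) (rule that)
  define S where "S = {x \<in> A. \<not> int p dvd h x}"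
  have S: "finite S" "S \<subseteq> A" using A by (auto simp: S_def)
  \<comment> \<open>Contracting the third coordinate with \<open>h\<close> leaves a diagonal matrix of rank \<open>card S\<close>.\<close>
  have "card S \<le> card I1 + card I2"
  proof (rule ccontr)
    assume "\<not> card S \<le> card I1 + card I2"
    \<comment> \<open>If the rank were smaller, some \<open>u\<close> on \<open>S\<close>, nonzero
      modulo p at some \<open>y\<close>, would annihilate every \<open>f1 i\<close> and every
      contracted \<open>g2 i\<close>. This \<open>y\<close> becomes the fixed second
      coordinate.\<close>
    then have "card (I1 <+> I2) < card S" using I by (simp add: card_Plus)
    then obtain u y where y: "y \<in> S" "\<not> int p dvd u y" and
      u: "\<And>e. e \<in> I1 <+> I2 \<Longrightarrow>
        int p dvd (\<Sum>x\<in>S. u x * (case e of Inl i \<Rightarrow> f1 i x | Inr i \<Rightarrow> \<Sum>z\<in>A. h z * g2 i x z))"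
      by (rule homogeneous_system_mod[OF prime_gt_1_nat[OF p] S(1) finite_Plus[OF I(1,2)], of
            "\<lambda>e x. case e of Inl i \<Rightarrow> f1 i x | Inr i \<Rightarrow> \<Sum>z\<in>A. h z * g2 i x z"])
        auto
    have u1: "int p dvd (\<Sum>x\<in>S. u x * f1 i x)" if "i \<in> I1" for i
      using u[of "Inl i"] that by auto
    have u2: "int p dvd (\<Sum>x\<in>S. u x * (\<Sum>z\<in>A. h z * g2 i x z))" if "i \<in> I2" for i
      using u[of "Inr i"] that by auto
    have yA: "y \<in> A" using y S by auto
    define T where "T x z = (\<Sum>i\<in>I1. f1 i x * g1 i y z) + (\<Sum>i\<in>I2. f2 i y * g2 i x z)
      + (\<Sum>i\<in>I3. f3 i z * g3 i x y)" for x z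
    have swap: "(\<Sum>x\<in>S. \<Sum>z\<in>A. \<Sum>i\<in>I. F x z i) = (\<Sum>i\<in>I. \<Sum>x\<in>S. \<Sum>z\<in>A. F x z i)"
      for F :: "'a \<Rightarrow> 'a \<Rightarrow> 'b \<Rightarrow> int" and I
      by (subst sum.swap[of _ I A]) (rule sum.swap)
    \<comment> \<open>The double sum is evaluated twice. Slice by slice it vanishes modulo p; from
      the diagonal form it is \<open>u y * h y\<close>, a product of two factors prime to p.\<close>
    have "(\<Sum>x\<in>S. \<Sum>z\<in>A. u x * h z * T x z) =
        (\<Sum>x\<in>S. \<Sum>z\<in>A. \<Sum>i\<in>I1. (u x * f1 i x) * (h z * g1 i y z))
      + (\<Sum>x\<in>S. \<Sum>z\<in>A. \<Sum>i\<in>I2. f2 i y * (u x * (h z * g2 i x z)))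
      + (\<Sum>x\<in>S. \<Sum>z\<in>A. \<Sum>i\<in>I3. (h z * f3 i z) * (u x * g3 i x y))"
      by (simp add: T_def distrib_left sum.distrib sum_distrib_left mult_ac)
    also have "(\<Sum>x\<in>S. \<Sum>z\<in>A. \<Sum>i\<in>I1. (u x * f1 i x) * (h z * g1 i y z)) =
        (\<Sum>i\<in>I1. (\<Sum>x\<in>S. u x * f1 i x) * (\<Sum>z\<in>A. h z * g1 i y z))"
      by (simp add: swap sum_product)
    also have "(\<Sum>x\<in>S. \<Sum>z\<in>A. \<Sum>i\<in>I2. f2 i y * (u x * (h z * g2 i x z))) =
        (\<Sum>i\<in>I2. f2 i y * (\<Sum>x\<in>S. u x * (\<Sum>z\<in>A. h z * g2 i x z)))"
      by (simp only: swap sum_distrib_left)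
    also have "(\<Sum>x\<in>S. \<Sum>z\<in>A. \<Sum>i\<in>I3. (h z * f3 i z) * (u x * g3 i x y)) =
        (\<Sum>i\<in>I3. (\<Sum>z\<in>A. h z * f3 i z) * (\<Sum>x\<in>S. u x * g3 i x y))"
      unfolding swap sum_product by (intro sum.cong refl sum.swap)
    finally have "int p dvd (\<Sum>x\<in>S. \<Sum>z\<in>A. u x * h z * T x z)"
      by (simp only:) (intro dvd_add dvd_sum dvd_mult2[OF u1] dvd_mult[OF u2] dvd_mult2[OF h])
    moreover have "[(\<Sum>x\<in>S. \<Sum>z\<in>A. u x * h z * T x z) =
        (\<Sum>x\<in>S. \<Sum>z\<in>A. u x * h z * (if x = y \<and> y = z then 1 else 0))] (mod int p)"
      using S yA unfolding T_def by (intro cong_sum cong_scalar_left T) auto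
    moreover have "(\<Sum>x\<in>S. \<Sum>z\<in>A. u x * h z * (if x = y \<and> y = z then 1 else 0)) =
        (\<Sum>x\<in>S. if x = y then (\<Sum>z\<in>A. if z = y then u x * h z else 0) else 0)"
      by (auto intro!: sum.cong)
    then have "(\<Sum>x\<in>S. \<Sum>z\<in>A. u x * h z * (if x = y \<and> y = z then 1 else 0)) = u y * h y"
      using S A y yA by simp
    ultimately have "int p dvd u y * h y" by (simp add: cong_dvd_iff)
    then show False using p y by (auto simp: prime_dvd_mult_iff S_def)
  qed
  then show ?thesis using card by (simp add: S_def)
qed


section \<open>Expansion into monomials and grouping into slices\<close>

lemma one_minus_trinomial_power:
  fixes b1 b2 b3 :: "'a :: comm_ring_1"
  obtains D :: "(nat \<times> nat) option set" and c :: "(nat \<times> nat) option \<Rightarrow> 'a" and \<alpha> \<beta> \<gamma>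
  where "finite D" "\<And>d. d \<in> D \<Longrightarrow> \<alpha> d + \<beta> d + \<gamma> d \<le> N"
    "\<And>x y z. 1 - (b1 * x + b2 * y + b3 * z) ^ N = (\<Sum>d\<in>D. c d * (x ^ \<alpha> d * y ^ \<beta> d * z ^ \<gamma> d))"
proof -
  \<comment> \<open>The index \<open>None\<close> stands for the constant 1, and
    \<open>Some (i, j)\<close> for the monomial with exponents i, j, N - i - j, whose multinomial
    coefficient is written as a product of two binomials and negated.\<close>
  define S where "S = (SIGMA i:{..N}. {..N - i})"
  define c where "c d = (case d of None \<Rightarrow> 1 | Some (i, j) \<Rightarrow>
    - (of_nat (N choose i) * of_nat ((N - i) choose j) * b1 ^ i * b2 ^ j * b3 ^ (N - i - j)))" for d
  define \<alpha> where "\<alpha> d = (case d of None \<Rightarrow> 0 | Some (i, j) \<Rightarrow> i)" for d :: "(nat \<times> nat) option"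
  define \<beta> where "\<beta> d = (case d of None \<Rightarrow> 0 | Some (i, j) \<Rightarrow> j)" for d :: "(nat \<times> nat) option"
  define \<gamma> where "\<gamma> d = (case d of None \<Rightarrow> 0 | Some (i, j) \<Rightarrow> N - i - j)" for d :: "(nat \<times> nat) option"
  have S: "finite S" by (auto simp: S_def)
  show thesis
  proof (rule that[of "insert None (Some ` S)" \<alpha> \<beta> \<gamma> c])
    show "finite (insert None (Some ` S))" using S by simp
    show "\<alpha> d + \<beta> d + \<gamma> d \<le> N" if "d \<in> insert None (Some ` S)" for d
      using that by (auto simp: \<alpha>_def \<beta>_def \<gamma>_def S_def)
    fix x y z
    have "(b1 * x + b2 * y + b3 * z) ^ N = (b1 * x + (b2 * y + b3 * z)) ^ N"
      by (simp add: add.assoc)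
    also have "\<dots> = (\<Sum>i\<le>N. \<Sum>j\<le>N - i. of_nat (N choose i) * (b1 * x) ^ i *
        (of_nat ((N - i) choose j) * (b2 * y) ^ j * (b3 * z) ^ (N - i - j)))"
      by (subst binomial_ring, subst binomial_ring) (simp add: sum_distrib_left)
    also have "\<dots> = (\<Sum>(i, j)\<in>S. of_nat (N choose i) * (b1 * x) ^ i *
        (of_nat ((N - i) choose j) * (b2 * y) ^ j * (b3 * z) ^ (N - i - j)))"
      unfolding S_def by (subst sum.Sigma) auto
    also have "\<dots> = (\<Sum>d\<in>Some ` S. - c d * (x ^ \<alpha> d * y ^ \<beta> d * z ^ \<gamma> d))"
      by (subst sum.reindex)
        (auto simp: c_def \<alpha>_def \<beta>_def \<gamma>_def power_mult_distrib mult_ac intro!: sum.cong)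
    finally show "1 - (b1 * x + b2 * y + b3 * z) ^ N =
        (\<Sum>d\<in>insert None (Some ` S). c d * (x ^ \<alpha> d * y ^ \<beta> d * z ^ \<gamma> d))"
      using S by (subst sum.insert) (auto simp: c_def \<alpha>_def \<beta>_def \<gamma>_def sum_negf)
  qed
qed

text \<open>Each term is assigned to the first of its three exponents lying in \<open>M\<close>.
  Terms sharing that exponent are collected, and the remaining factors form \<open>g1\<close>,
  \<open>g2\<close> or \<open>g3\<close>.\<close>

lemma sum_group_slices:
  fixes F :: "'e \<Rightarrow> 'v \<Rightarrow> 'a :: comm_semiring_1" and C :: "'d \<Rightarrow> 'a"
  assumes \<Delta>: "finite \<Delta>" and M: "finite M"
    and cover: "\<And>\<delta>. \<delta> \<in> \<Delta> \<Longrightarrow> e1 \<delta> \<in> M \<or> e2 \<delta> \<in> M \<or> e3 \<delta> \<in> M"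
  obtains g1 g2 g3 :: "'e \<Rightarrow> 'v \<Rightarrow> 'v \<Rightarrow> 'a" where
    "\<And>x y z. (\<Sum>\<delta>\<in>\<Delta>. C \<delta> * (F (e1 \<delta>) x * F (e2 \<delta>) y * F (e3 \<delta>) z)) =
      (\<Sum>e\<in>M. F e x * g1 e y z) + (\<Sum>e\<in>M. F e y * g2 e x z) + (\<Sum>e\<in>M. F e z * g3 e x y)"
proof -
  define D1 where "D1 = {\<delta> \<in> \<Delta>. e1 \<delta> \<in> M}"
  define D2 where "D2 = {\<delta> \<in> \<Delta> - D1. e2 \<delta> \<in> M}"
  define D3 where "D3 = \<Delta> - D1 - D2"
  have fin: "finite D1" "finite D2" "finite D3" using \<Delta> by (auto simp: D1_def D2_def D3_def)
  have img: "e1 ` D1 \<subseteq> M" "e2 ` D2 \<subseteq> M" "e3 ` D3 \<subseteq> M"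
    using cover by (auto simp: D1_def D2_def D3_def)
  define g1 where "g1 e y z = (\<Sum>\<delta>\<in>{\<delta> \<in> D1. e1 \<delta> = e}. C \<delta> * (F (e2 \<delta>) y * F (e3 \<delta>) z))" for e y z
  define g2 where "g2 e x z = (\<Sum>\<delta>\<in>{\<delta> \<in> D2. e2 \<delta> = e}. C \<delta> * (F (e1 \<delta>) x * F (e3 \<delta>) z))" for e x z
  define g3 where "g3 e x y = (\<Sum>\<delta>\<in>{\<delta> \<in> D3. e3 \<delta> = e}. C \<delta> * (F (e1 \<delta>) x * F (e2 \<delta>) y))" for e x y
  show thesis
  proof (rule that[of g1 g2 g3])
    fix x y z
    define t where "t \<delta> = C \<delta> * (F (e1 \<delta>) x * F (e2 \<delta>) y * F (e3 \<delta>) z)" for \<delta>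
    have "\<Delta> = D1 \<union> (D2 \<union> D3)" by (auto simp: D1_def D2_def D3_def)
    then have "sum t \<Delta> = sum t D1 + (sum t D2 + sum t D3)"
      using sum.union_disjoint[OF fin(1), of "D2 \<union> D3" t] sum.union_disjoint[OF fin(2,3), of t] fin
      by (auto simp: D2_def D3_def)
    moreover have "sum t D1 = (\<Sum>e\<in>M. F e x * g1 e y z)"
      unfolding sum.group[OF fin(1) M img(1), symmetric] g1_def sum_distrib_left
      by (intro sum.cong) (auto simp: t_def mult_ac)
    moreover have "sum t D2 = (\<Sum>e\<in>M. F e y * g2 e x z)"
      unfolding sum.group[OF fin(2) M img(2), symmetric] g2_def sum_distrib_left
      by (intro sum.cong) (auto simp: t_def mult_ac)
    moreover have "sum t D3 = (\<Sum>e\<in>M. F e z * g3 e x y)"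
      unfolding sum.group[OF fin(3) M img(3), symmetric] g3_def sum_distrib_left
      by (intro sum.cong) (auto simp: t_def mult_ac)
    ultimately show "(\<Sum>\<delta>\<in>\<Delta>. C \<delta> * (F (e1 \<delta>) x * F (e2 \<delta>) y * F (e3 \<delta>) z)) =
      (\<Sum>e\<in>M. F e x * g1 e y z) + (\<Sum>e\<in>M. F e y * g2 e x z) + (\<Sum>e\<in>M. F e z * g3 e x y)"
      by (simp add: t_def add.assoc)
  qed
qed

section \<open>Counting monomials of low degree\<close>

text \<open>The inequality says, without division, that the total degree is at most a third of the
  maximum \<open>N * card J\<close>.\<close>

definition low_degree_exponents :: "nat \<Rightarrow> 'j set \<Rightarrow> ('j \<Rightarrow> nat) set"
  where "low_degree_exponents N J = {e \<in> J \<rightarrow>\<^sub>E {..N}. 3 * (\<Sum>j\<in>J. e j) \<le> N * card J}"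

lemma finite_low_degree_exponents: "finite J \<Longrightarrow> finite (low_degree_exponents N J)"
  unfolding low_degree_exponents_def by (auto intro!: finite_PiE)

text \<open>Chernoff bound: since s \<le> 1, each low-degree \<open>e\<close> has weight s^(3 *
  degree) at least \<open>s ^ (N * card J)\<close>, and the total weight of all exponent vectors
  factors over \<open>J\<close>. The factor 3 avoids cube roots.\<close>

lemma card_low_degree_exponents_le:
  fixes s :: real
  assumes s: "0 < s" "s \<le> 1" and J: "finite J"
  shows "real (card (low_degree_exponents N J)) \<le> ((\<Sum>i\<le>N. s ^ (3 * i)) / s ^ N) ^ card J"
proof -
  have "real (card (low_degree_exponents N J)) * s ^ (N * card J)
      = (\<Sum>e\<in>low_degree_exponents N J. s ^ (N * card J))" by simp
  also have "\<dots> \<le> (\<Sum>e\<in>low_degree_exponents N J. \<Prod>j\<in>J. s ^ (3 * e j))"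
    unfolding power_sum[symmetric] sum_distrib_left[symmetric]
    using s by (intro sum_mono power_decreasing) (auto simp: low_degree_exponents_def)
  also have "\<dots> \<le> (\<Sum>e\<in>J \<rightarrow>\<^sub>E {..N}. \<Prod>j\<in>J. s ^ (3 * e j))"
    using s J by (intro sum_mono2 finite_PiE) (auto simp: low_degree_exponents_def intro!: prod_nonneg)
  also have "\<dots> = (\<Sum>i\<le>N. s ^ (3 * i)) ^ card J"
    using J by (subst prod_sum_PiE[symmetric]) auto
  finally show ?thesis using s by (simp add: power_divide power_mult field_simps)
qed

text \<open>
  With \<open>f s = (\<Sum>i\<le>N. s ^ (3 * i)) - (N + 1) * s ^ N\<close> one has \<open>f 1 = 0\<close> and
  \<open>f' 1 = N * (N + 1) / 2 > 0\<close>, so \<open>f\<close> is negative just below \<open>1\<close>.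
\<close>
lemma exists_sum_powers_less:
  assumes N: "N > 0"
  shows "\<exists>s::real. 0 < s \<and> s \<le> 1 \<and> (\<Sum>i\<le>N. s ^ (3 * i)) / s ^ N < real (Suc N)"
proof -
  let ?f = "\<lambda>s::real. (\<Sum>i\<le>N. s ^ (3 * i)) - real (Suc N) * s ^ N"
  have "(\<Sum>i\<le>N. real i) = real N * real (Suc N) / 2"
    by (induction N) (auto simp: field_simps)
  then have "(\<Sum>i\<le>N. real (3 * i)) - real (Suc N) * real N = real N * real (Suc N) / 2"
    by (simp add: sum_distrib_left[symmetric])
  moreover have "(?f has_real_derivative (\<Sum>i\<le>N. real (3 * i)) - real (Suc N) * real N) (at 1)"
    by (auto intro!: derivative_eq_intros)
  ultimately have "(?f has_real_derivative real N * real (Suc N) / 2) (at 1)" by (simp only:)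
  then obtain d where d: "d > 0" "\<And>h. h > 0 \<Longrightarrow> h < d \<Longrightarrow> ?f (1 - h) < ?f 1"
    using DERIV_pos_inc_left[of ?f "real N * real (Suc N) / 2" 1] N by auto
  \<comment> \<open>Halving \<open>d\<close> makes \<open>h\<close> strictly smaller than
    \<open>d\<close>; the cap 1/2 keeps 1 - h positive.\<close>
  define h where "h = min (d / 2) (1 / 2)"
  have h: "h > 0" "h < d" "h < 1" using d by (auto simp: h_def)
  have "?f (1 - h) < 0" using d(2)[OF h(1,2)] by simp
  then show ?thesis using h by (intro exI[of _ "1 - h"]) (auto simp: field_simps)
qed

section \<open>The polynomial method\<close>

lemma fermat_theorem_int:
  fixes a :: int
  assumes "prime p" and "\<not> int p dvd a"
  shows "[a ^ (p - 1) = 1] (mod int p)"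
proof -
  have p: "p > 0" using assms by (simp add: prime_gt_0_nat)
  define r where "r = nat (a mod int p)"
  have r: "int r = a mod int p" using p by (simp add: r_def)
  then have "\<not> p dvd r" using assms(2) by (metis dvd_mod_iff dvd_refl int_dvd_int_iff)
  then have "[r ^ (p - 1) = 1] (mod p)" by (rule fermat_theorem[OF assms(1)])
  then have "[int r ^ (p - 1) = 1] (mod int p)" by (metis cong_int_iff of_nat_1 of_nat_power)
  moreover have "[a ^ (p - 1) = int r ^ (p - 1)] (mod int p)"
    unfolding r by (intro cong_pow) (simp add: cong_def)
  ultimately show ?thesis by (rule cong_trans[rotated])
qed

text \<open>By Fermat, 1 - L^(p-1) is 1 or 0 modulo p according to whether p divides L, so the
  product over coordinates detects solutions. Constant triples are solutions because p divides b1 +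
  b2 + b3, and \<open>trivial\<close> says there are no others.\<close>

lemma card_le_of_only_trivial_solutions:
  fixes p n :: nat and b1 b2 b3 :: int and A :: "(nat \<Rightarrow> int) set"
  assumes p: "prime p" and A: "finite A" and b: "int p dvd b1 + b2 + b3"
    and trivial: "\<And>x y z. x \<in> A \<Longrightarrow> y \<in> A \<Longrightarrow> z \<in> A \<Longrightarrow>
      (\<And>j. j \<in> {1..n} \<Longrightarrow> int p dvd b1 * x j + b2 * y j + b3 * z j) \<Longrightarrow> x = y \<and> y = z"
  shows "card A \<le> 3 * card (low_degree_exponents (p - 1) {1..n})"
proof -
  define N where "N = p - 1"
  have N: "N > 0" using prime_gt_1_nat[OF p] by (simp add: N_def)
  define J where "J = {1..n}"
  have J: "finite J" by (simp add: J_def)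
  define M where "M = low_degree_exponents N J"
  have M: "finite M" using J by (simp add: M_def finite_low_degree_exponents)
  obtain D :: "(nat \<times> nat) option set" and c :: "(nat \<times> nat) option \<Rightarrow> int" and \<alpha> \<beta> \<gamma>
    where D: "finite D" "\<And>d. d \<in> D \<Longrightarrow> \<alpha> d + \<beta> d + \<gamma> d \<le> N"
    and expand: "\<And>x y z. 1 - (b1 * x + b2 * y + b3 * z) ^ N =
      (\<Sum>d\<in>D. c d * (x ^ \<alpha> d * y ^ \<beta> d * z ^ \<gamma> d))"
    by (rule one_minus_trinomial_power[where N = N and ?b1.0 = b1 and ?b2.0 = b2 and ?b3.0 = b3])
      (rule that)
  define mon where "mon e x = (\<Prod>j\<in>J. x j ^ e j)" for e and x :: "nat \<Rightarrow> int"
  \<comment> \<open>Multiplying out the product over \<open>J\<close> selects a term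
    \<open>\<delta> j\<close> in each factor. \<open>res\<close> reads off the exponent vector of
    one variable, restricted to \<open>J\<close> so that it can belong to \<open>M\<close>.\<close>
  define res where "res \<epsilon> \<delta> = (\<lambda>j\<in>J. \<epsilon> (\<delta> j))" for \<epsilon> :: "(nat \<times> nat) option \<Rightarrow> nat" and \<delta>
  have cover: "res \<alpha> \<delta> \<in> M \<or> res \<beta> \<delta> \<in> M \<or> res \<gamma> \<delta> \<in> M" if \<delta>: "\<delta> \<in> J \<rightarrow>\<^sub>E D" for \<delta>
  proof -
    have le: "\<alpha> (\<delta> j) + \<beta> (\<delta> j) + \<gamma> (\<delta> j) \<le> N" if "j \<in> J" for j using \<delta> D(2) that by auto
    then have "\<alpha> (\<delta> j) \<le> N" "\<beta> (\<delta> j) \<le> N" "\<gamma> (\<delta> j) \<le> N" if "j \<in> J" for j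
      using that by (meson add_leD1 add_leD2)+
    moreover have "(\<Sum>j\<in>J. \<alpha> (\<delta> j) + \<beta> (\<delta> j) + \<gamma> (\<delta> j)) \<le> N * card J"
      using sum_bounded_above[OF le, of J] by (simp add: mult.commute)
    then have "(\<Sum>j\<in>J. \<alpha> (\<delta> j)) + (\<Sum>j\<in>J. \<beta> (\<delta> j)) + (\<Sum>j\<in>J. \<gamma> (\<delta> j)) \<le> N * card J"
      by (simp add: sum.distrib)
    \<comment> \<open>Averaging: the three degrees add up to at most \<open>N * card J\<close>, so
      one is at most a third of it.\<close>
    then have "3 * (\<Sum>j\<in>J. \<alpha> (\<delta> j)) \<le> N * card J \<or> 3 * (\<Sum>j\<in>J. \<beta> (\<delta> j)) \<le> N * card J
        \<or> 3 * (\<Sum>j\<in>J. \<gamma> (\<delta> j)) \<le> N * card J" by linarith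
    ultimately show ?thesis by (auto simp: M_def low_degree_exponents_def res_def)
  qed
  obtain g1 g2 g3 where g:
    "\<And>x y z. (\<Sum>\<delta>\<in>J \<rightarrow>\<^sub>E D. (\<Prod>j\<in>J. c (\<delta> j)) * (mon (res \<alpha> \<delta>) x * mon (res \<beta> \<delta>) y * mon (res \<gamma> \<delta>) z)) =
      (\<Sum>e\<in>M. mon e x * g1 e y z) + (\<Sum>e\<in>M. mon e y * g2 e x z) + (\<Sum>e\<in>M. mon e z * g3 e x y)"
    by (rule sum_group_slices[OF finite_PiE[OF J D(1)] M,
          where F = mon and ?e1.0 = "res \<alpha>" and ?e2.0 = "res \<beta>" and ?e3.0 = "res \<gamma>"
            and C = "\<lambda>\<delta>. \<Prod>j\<in>J. c (\<delta> j)"]) (erule cover, rule that)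
  have "card A \<le> card M + card M + card M"
  proof (rule slice_rank_diagonal[OF p A M M M])
    fix x y z assume xyz: "x \<in> A" "y \<in> A" "z \<in> A"
    define L where "L j = b1 * x j + b2 * y j + b3 * z j" for j
    have "(\<Prod>j\<in>J. 1 - L j ^ N) = (\<Sum>\<delta>\<in>J \<rightarrow>\<^sub>E D. (\<Prod>j\<in>J. c (\<delta> j)) *
        (mon (res \<alpha> \<delta>) x * mon (res \<beta> \<delta>) y * mon (res \<gamma> \<delta>) z))"
      unfolding L_def expand using J D(1)
      by (subst prod_sum_PiE) (auto simp: mon_def res_def prod.distrib)
    moreover have "[(\<Prod>j\<in>J. 1 - L j ^ N) = (if x = y \<and> y = z then 1 else 0)] (mod int p)"
    proof (cases "\<forall>j\<in>J. int p dvd L j")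
      case True
      then have "x = y \<and> y = z" using xyz by (intro trivial) (auto simp: L_def J_def)
      moreover have "[(\<Prod>j\<in>J. 1 - L j ^ N) = (\<Prod>j\<in>J. 1)] (mod int p)"
      proof (intro cong_prod)
        fix j assume "j \<in> J"
        then have "int p dvd L j ^ N" using True N by (meson dvd_power dvd_trans)
        then show "[1 - L j ^ N = 1] (mod int p)" by (simp add: cong_iff_dvd_diff)
      qed
      ultimately show ?thesis by simp
    next
      case False
      then obtain j where j: "j \<in> J" "\<not> int p dvd L j" by auto
      have "[L j ^ N = 1] (mod int p)" unfolding N_def by (rule fermat_theorem_int[OF p j(2)])
      then have "int p dvd 1 - L j ^ N" by (metis cong_iff_dvd_diff cong_sym)
      then have "int p dvd (\<Prod>j\<in>J. 1 - L j ^ N)" using J j(1) by (meson dvd_prodI dvd_trans)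
      moreover have "\<not> (x = y \<and> y = z)"
      proof
        assume "x = y \<and> y = z"
        then have "L j = (b1 + b2 + b3) * x j" by (simp add: L_def algebra_simps)
        then show False using b j(2) by auto
      qed
      then have "(if x = y \<and> y = z then 1 else 0 :: int) = 0" by simp
      ultimately show ?thesis by (simp only: cong_0_iff)
    qed
    ultimately show "[(\<Sum>e\<in>M. mon e x * g1 e y z) + (\<Sum>e\<in>M. mon e y * g2 e x z) +
        (\<Sum>e\<in>M. mon e z * g3 e x y) = (if x = y \<and> y = z then 1 else 0)] (mod int p)"
      by (simp only: g)
  qed
  then show ?thesis by (simp add: M_def N_def J_def)
qed

section \<open>Passage between the residue ring and integer congruences\<close>

lemma GFp_finsum:
  assumes p: "prime p" and I: "finite I"
  shows "(\<Oplus>\<^bsub>GFp p\<^esub>i\<in>I. f i mod int p) = (\<Sum>i\<in>I. f i) mod int p"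
proof -
  interpret residues "int p" "GFp p"
    using prime_gt_1_nat[OF p] by unfold_locales auto
  show ?thesis by (rule sum_cong[OF I])
qed

lemma GFp_finsum_carrier:
  assumes p: "prime p" and I: "finite I" and f: "f \<in> I \<rightarrow> carrier (GFp p)"
  shows "(\<Oplus>\<^bsub>GFp p\<^esub>i\<in>I. f i) = (\<Sum>i\<in>I. f i) mod int p"
proof -
  interpret residues "int p" "GFp p"
    using prime_gt_1_nat[OF p] by unfold_locales auto
  have "(\<Oplus>\<^bsub>GFp p\<^esub>i\<in>I. f i) = (\<Oplus>\<^bsub>GFp p\<^esub>i\<in>I. f i mod int p)"
    using f by (intro finsum_cong') (auto simp: res_carrier_eq Pi_iff)
  then show ?thesis by (simp only: sum_cong[OF I])
qed

lemma lin_comb_eq_zero_vector: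
  assumes p: "prime p" and "\<And>j. j \<in> {1..n} \<Longrightarrow> int p dvd (\<Sum>i\<in>{1..k}. a i * x i j)"
  shows "lin_comb p n k a x = zero_vector p n"
  unfolding lin_comb_def zero_vector_def
proof (rule restrict_ext)
  fix j assume "j \<in> {1..n}"
  then have "(\<Oplus>\<^bsub>GFp p\<^esub>i\<in>{1..k}. (a i * x i j) mod int p) = 0"
    using assms(2) by (subst GFp_finsum[OF p]) auto
  then show "(\<Oplus>\<^bsub>GFp p\<^esub>i\<in>{1..k}. a i \<otimes>\<^bsub>GFp p\<^esub> x i j) = \<zero>\<^bsub>GFp p\<^esub>"
    by (simp add: residue_ring_def)
qed

section \<open>Choice of constants and reduction to three vectors\<close>

theorem mainTheorem5:
  shows "\<exists>(C :: nat \<Rightarrow> real) (\<Gamma> :: nat \<Rightarrow> nat \<Rightarrow> real).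
    \<forall>p k m :: nat. prime p \<and> 3 \<le> m \<and> m \<le> k \<and> \<not> p dvd Stirling k m \<longrightarrow>
      C k \<ge> 1 \<and> 1 \<le> \<Gamma> p m \<and> \<Gamma> p m < real p \<and>
      (\<forall>(n :: nat) (a :: nat \<Rightarrow> int) (A :: (nat \<Rightarrow> int) set).
        n \<ge> 1 \<and>
        a \<in> {1..k} \<rightarrow> carrier (GFp p) \<and>
        (\<Oplus>\<^bsub>GFp p\<^esub>i\<in>{1..k}. a i) = \<zero>\<^bsub>GFp p\<^esub> \<and>
        A \<subseteq> Fp_vectors p n \<and>
        real (card A) > C k * \<Gamma> p m ^ n \<longrightarrow>
        (\<exists>x :: nat \<Rightarrow> nat \<Rightarrow> int.
          x \<in> {1..k} \<rightarrow> A \<and>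
          (\<exists>i\<in>{1..k}. \<exists>j\<in>{1..k}. x i \<noteq> x j) \<and>
          card (x ` {1..k}) \<le> m \<and>
          lin_comb p n k a x = zero_vector p n))"
proof -
  \<comment> \<open>The constants are quantified before p, so the parameter s is turned into a
    function of p by choice.\<close>
  have "\<exists>s::real. 0 < s \<and> s \<le> 1 \<and> (\<Sum>i\<le>p - 1. s ^ (3 * i)) / s ^ (p - 1) < real p"
    if "prime p" for p
    using exists_sum_powers_less[of "p - 1"] prime_gt_1_nat[OF that] by simp
  then obtain s :: "nat \<Rightarrow> real" where s: "\<And>p. prime p \<Longrightarrow> 0 < s p" "\<And>p. prime p \<Longrightarrow> s p \<le> 1"
    "\<And>p. prime p \<Longrightarrow> (\<Sum>i\<le>p - 1. s p ^ (3 * i)) / s p ^ (p - 1) < real p"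
    by metis
  define \<Gamma> where "\<Gamma> p = (\<Sum>i\<le>p - 1. s p ^ (3 * i)) / s p ^ (p - 1)" for p
  have \<Gamma>_ge: "1 \<le> \<Gamma> p" if p: "prime p" for p
  proof -
    \<comment> \<open>The denominator of \<open>\<Gamma> p\<close> is at most 1, while the term i =
      0 of the numerator is already 1.\<close>
    have "s p ^ (p - 1) \<le> 1" using s p by (simp add: power_le_one less_imp_le)
    also have "1 = (\<Sum>i\<in>{0::nat}. s p ^ (3 * i))" by simp
    also have "\<dots> \<le> (\<Sum>i\<le>p - 1. s p ^ (3 * i))"
      using s(1)[OF p] by (intro sum_mono2) auto
    finally show ?thesis using s(1)[OF p] by (simp add: \<Gamma>_def)
  qed
  show ?thesis
  \<comment> \<open>The constant 3 counts the three groups of slices.\<close>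
  proof (rule exI[of _ "\<lambda>_. 3"], rule exI[of _ "\<lambda>p _. \<Gamma> p"], intro allI impI conjI)
    fix p k m :: nat
    assume "prime p \<and> 3 \<le> m \<and> m \<le> k \<and> \<not> p dvd Stirling k m"
    then have p: "prime p" and m: "3 \<le> m" "m \<le> k" by auto
    show "(1::real) \<le> 3" by simp
    show "1 \<le> \<Gamma> p" by (rule \<Gamma>_ge[OF p])
    show "\<Gamma> p < real p" using s(3)[OF p] by (simp add: \<Gamma>_def)
    fix n :: nat and a :: "nat \<Rightarrow> int" and A :: "(nat \<Rightarrow> int) set"
    assume "n \<ge> 1 \<and> a \<in> {1..k} \<rightarrow> carrier (GFp p) \<and>
        (\<Oplus>\<^bsub>GFp p\<^esub>i\<in>{1..k}. a i) = \<zero>\<^bsub>GFp p\<^esub> \<and>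
        A \<subseteq> Fp_vectors p n \<and> real (card A) > 3 * \<Gamma> p ^ n"
    then have a: "a \<in> {1..k} \<rightarrow> carrier (GFp p)" "(\<Oplus>\<^bsub>GFp p\<^esub>i\<in>{1..k}. a i) = \<zero>\<^bsub>GFp p\<^esub>"
      and big: "real (card A) > 3 * \<Gamma> p ^ n" by auto
    have "0 \<le> \<Gamma> p ^ n" using \<Gamma>_ge[OF p] by simp
    \<comment> \<open>An infinite set has \<open>card\<close> equal to 0, so positivity yields
      finiteness.\<close>
    then have "card A > 0" using big by linarith
    then have A: "finite A" by (rule card_ge_0_finite)
    have k: "{1..k} = {1, 2} \<union> {3..k}" "k \<ge> 3" using m by auto
    have split: "(\<Sum>i\<in>{1..k}. h i) = h 1 + h 2 + (\<Sum>i\<in>{3..k}. h i)" for h :: "nat \<Rightarrow> int"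
      unfolding k(1) by (subst sum.union_disjoint) auto
    \<comment> \<open>Since one vector \<open>w\<close> will occupy all indices from 3 on, its
      effective coefficient is the sum of theirs, and a 1 + a 2 + b still vanishes modulo p.\<close>
    define b where "b = (\<Sum>i\<in>{3..k}. a i)"
    have "(\<Sum>i\<in>{1..k}. a i) mod int p = 0"
      using a GFp_finsum_carrier[OF p _ a(1)] by (simp add: residue_ring_def)
    then have sum0: "int p dvd a 1 + a 2 + b" by (simp only: split b_def mod_eq_0_iff_dvd)
    have "real (card (low_degree_exponents (p - 1) {1..n})) \<le> \<Gamma> p ^ n"
      using card_low_degree_exponents_le[OF s(1,2)[OF p], of "{1..n}" "p - 1"] by (simp add: \<Gamma>_def)
    then have "\<not> card A \<le> 3 * card (low_degree_exponents (p - 1) {1..n})" using big by linarith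
    then obtain u v w where uvw: "u \<in> A" "v \<in> A" "w \<in> A" "\<not> (u = v \<and> v = w)"
      and sol: "\<And>j. j \<in> {1..n} \<Longrightarrow> int p dvd a 1 * u j + a 2 * v j + b * w j"
      using card_le_of_only_trivial_solutions[OF p A sum0] by blast
    define x where "x i = (if i = 1 then u else if i = 2 then v else w)" for i :: nat
    show "\<exists>x :: nat \<Rightarrow> nat \<Rightarrow> int. x \<in> {1..k} \<rightarrow> A \<and> (\<exists>i\<in>{1..k}. \<exists>j\<in>{1..k}. x i \<noteq> x j) \<and>
        card (x ` {1..k}) \<le> m \<and> lin_comb p n k a x = zero_vector p n"
    proof (intro exI[of _ x] conjI)
      show "x \<in> {1..k} \<rightarrow> A" using uvw by (auto simp: x_def)
      have "x 1 \<noteq> x 2 \<or> x 2 \<noteq> x 3" using uvw(4) by (auto simp: x_def)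
      moreover have "1 \<in> {1..k}" "2 \<in> {1..k}" "3 \<in> {1..k}" using k(2) by auto
      ultimately show "\<exists>i\<in>{1..k}. \<exists>j\<in>{1..k}. x i \<noteq> x j" by blast
      have "card (x ` {1..k}) \<le> card {u, v, w}" by (intro card_mono) (auto simp: x_def)
      also have "\<dots> \<le> 3" by (simp add: card_insert_if)
      finally show "card (x ` {1..k}) \<le> m" using m by simp
      show "lin_comb p n k a x = zero_vector p n"
      proof (rule lin_comb_eq_zero_vector[OF p])
        fix j assume "j \<in> {1..n}"
        moreover have "(\<Sum>i\<in>{3..k}. a i * x i j) = b * w j"
          unfolding b_def sum_distrib_right by (intro sum.cong) (auto simp: x_def)
        moreover have "x 1 = u" "x 2 = v" by (simp_all add: x_def)
        ultimately show "int p dvd (\<Sum>i\<in>{1..k}. a i * x i j)"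
          using sol by (simp only: split)
      qed
    qed
  qed
qed

end
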